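(* If $(X,\delta)$ is a diversity on a set $X$ of three elements, or a finite diversity that can be embedded in $L_1$, then $(X,\delta)$ is Minkowski-embeddable.
   Context: A convex body in $\mathbb{R}^d$ is a compact, convex set with non-empty interior. For a convex body $K$ in $\mathbb{R}^d$ and bounded $A \subseteq \mathbb{R}^d$, the generalized circumradius of $A$ with respect to $K$ is \[R(A,K) = \inf\{\lambda \ge 0 : A \subseteq \lambda K+x \mbox{ for some } x \in \mathbb{R}^d\}.\] A diversity is a pair $(X,\delta)$ where $X$ is a set and $\delta$ is a function from the finite subsets of $X$ to $\mathbb{R}_{\geq 0}$ such that, for all finite $A,B,C \subseteq X$: (D1) $\delta(A)=0$ if and only if $|A| \leq 1$; (D2) if $B \neq \emptyset$ then $\delta(A \cup C) \leq \delta(A \cup B) + \delta(B \cup C)$. It is finite if $X$ is finite. A diversity $(X,\delta)$ is Minkowski-embeddable if for some $d$ there is a map $\phi:X \rightarrow \mathbb{R}^d$ and a convex body $K$ in $\mathbb{R}^d$ such that $\delta(A) = R(\phi(A),K)$ for all finite $A \subseteq X$. The $L_1$ diversity $(\mathbb{R}^d,\delta_1)$ is given by $\delta_1(A) = \sum_{i=1}^d \max\{|a_i-a'_i|:a,a' \in A\}$ for non-empty finite $A \subset \mathbb{R}^d$ and $\delta_1(\emptyset)=0$. A finite diversity $(X,\delta)$ can be embedded in $L_1$ if for some $d$ there is a map $\phi: X \to \mathbb{R}^d$ with $\delta(A) = \delta_1(\phi(A))$ for all $A \subseteq X$. *)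

theory Defs
  imports "HOL-Analysis.Analysis" "HOL-Library.Function_Algebras"
begin

(* The dimension d is existentially quantified below, so R^d is taken to be the carrier
   of the library's topology Euclidean_space d, i.e. the functions nat => real vanishing
   from index d on.  The pointwise vector space structure on functions gives access
   to the library's convexity. *)

instantiation "fun" :: (type, real_vector) real_vector
begin

definition scaleR_fun :: "real \<Rightarrow> ('a \<Rightarrow> 'b) \<Rightarrow> 'a \<Rightarrow> 'b" where
  "scaleR_fun c f = (\<lambda>x. c *\<^sub>R f x)"

instance
  by standard (simp_all add: scaleR_fun_def plus_fun_def fun_eq_iff
    scaleR_add_right scaleR_add_left)

end

definition convex_body :: "nat \<Rightarrow> (nat \<Rightarrow> real) set \<Rightarrow> bool" where
  "convex_body d K \<longleftrightarrow>
     compactin (Euclidean_space d) K \<and> convex K \<and> (Euclidean_space d) interior_of K \<noteq> {}"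

definition circumradius :: "nat \<Rightarrow> (nat \<Rightarrow> real) set \<Rightarrow> (nat \<Rightarrow> real) set \<Rightarrow> real" where
  "circumradius d A K =
     Inf {r. 0 \<le> r \<and> (\<exists>x \<in> topspace (Euclidean_space d). A \<subseteq> (\<lambda>k. r *\<^sub>R k + x) ` K)}"

(* Values of delta on infinite sets or on sets not contained in X are irrelevant. *)
definition diversity :: "'a set \<Rightarrow> ('a set \<Rightarrow> real) \<Rightarrow> bool" where
  "diversity X \<delta> \<longleftrightarrow>
     (\<forall>A. finite A \<and> A \<subseteq> X \<longrightarrow> 0 \<le> \<delta> A) \<and>
     (\<forall>A. finite A \<and> A \<subseteq> X \<longrightarrow> (\<delta> A = 0 \<longleftrightarrow> card A \<le> 1)) \<and>
     (\<forall>A B C. finite A \<and> finite B \<and> finite C \<and> A \<subseteq> X \<and> B \<subseteq> X \<and> C \<subseteq> X \<and> B \<noteq> {}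
        \<longrightarrow> \<delta> (A \<union> C) \<le> \<delta> (A \<union> B) + \<delta> (B \<union> C))"

definition Minkowski_embeddable :: "'a set \<Rightarrow> ('a set \<Rightarrow> real) \<Rightarrow> bool" where
  "Minkowski_embeddable X \<delta> \<longleftrightarrow>
     (\<exists>d \<phi> K. \<phi> \<in> X \<rightarrow> topspace (Euclidean_space d) \<and> convex_body d K \<and>
        (\<forall>A. finite A \<and> A \<subseteq> X \<longrightarrow> \<delta> A = circumradius d (\<phi> ` A) K))"

definition L1_diversity :: "nat \<Rightarrow> (nat \<Rightarrow> real) set \<Rightarrow> real" where
  "L1_diversity d A =
     (if A = {} then 0 else \<Sum>i<d. Max {\<bar>a i - a' i\<bar> | a a'. a \<in> A \<and> a' \<in> A})"

(* Used for finite X only, so that the image of every subset of X is finite. *)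
definition L1_embeddable :: "'a set \<Rightarrow> ('a set \<Rightarrow> real) \<Rightarrow> bool" where
  "L1_embeddable X \<delta> \<longleftrightarrow>
     (\<exists>d \<phi>. \<phi> \<in> X \<rightarrow> topspace (Euclidean_space d) \<and>
        (\<forall>A. A \<subseteq> X \<longrightarrow> \<delta> A = L1_diversity d (\<phi> ` A)))"

end

(* Let K be the standard simplex in R^n.  If the coordinates of all points of A sum to 0, then
   R(A,K) is the sum over j of max {-y j | y in A}: the best translate of K has its corner at
   the coordinatewise minimum of A.  Hence every diversity of the form
   delta(A) = sum over j of max {f j a | a in A}, with the f j summing to 0, is
   Minkowski-embeddable.  For the L1 diversity take the coordinates and their negatives.  For
   X = {1,2,3} with pair values d12, d13, d23 and delta(X) = t take the seven functions
   (t - d23) 1_{1}, (t - d12 - d13) 1_{1}, their analogues for the points 2 and 3, and the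
   constant d12 + d13 + d23 - 2 t. *)

theory Submission
  imports Defs
begin

text \<open>The inequality \<open>\<le> 1\<close>, in place of equality, makes this the
  full-dimensional simplex with corner at the origin. Vanishing from index \<open>n\<close> on
  places it in the carrier of \<open>Euclidean_space n\<close>.\<close>

definition std_simplex :: "nat \<Rightarrow> (nat \<Rightarrow> real) set" where
  "std_simplex n = {y. (\<forall>j<n. 0 \<le> y j) \<and> (\<forall>j\<ge>n. y j = 0) \<and> (\<Sum>j<n. y j) \<le> 1}"

lemma continuous_on_sum_coordinates:
  "continuous_on S (\<lambda>y::nat \<Rightarrow> real. \<Sum>j<n. y j)"
  by (intro continuous_on_sum continuous_on_subset[OF continuous_on_product_coordinates]) auto

text \<open>The simplex is a closed part of the box \<open>B\<close>, a product of compact intervals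
  and singletons.\<close>

lemma compact_std_simplex: "compact (std_simplex n)"
proof -
  define B where "B = PiE UNIV (\<lambda>j::nat. if j < n then {0..1::real} else {0})"
  have "compactin (product_topology (\<lambda>_. euclidean) UNIV) B"
    unfolding B_def compactin_PiE by auto
  then have "compact B"
    by (simp add: euclidean_product_topology)
  moreover have "closed {y::nat \<Rightarrow> real. (\<Sum>j<n. y j) \<le> 1}"
    by (intro closed_Collect_le continuous_on_sum_coordinates continuous_on_const)
  moreover have "y j \<le> 1" if "y \<in> std_simplex n" "j < n" for y j
    using that member_le_sum[of j "{..<n}" y] by (force simp: std_simplex_def)
  then have "std_simplex n = B \<inter> {y. (\<Sum>j<n. y j) \<le> 1}"
    by (auto simp: std_simplex_def B_def PiE_iff split: if_splits)
  ultimately show ?thesis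
    by auto
qed

lemma convex_std_simplex: "convex (std_simplex n)"
proof (rule convexI)
  fix x y :: "nat \<Rightarrow> real" and u v :: real
  assume x: "x \<in> std_simplex n" and y: "y \<in> std_simplex n"
    and uv: "0 \<le> u" "0 \<le> v" "u + v = 1"
  have "(\<Sum>j<n. (u *\<^sub>R x + v *\<^sub>R y) j) = u * (\<Sum>j<n. x j) + v * (\<Sum>j<n. y j)"
    by (simp add: scaleR_fun_def sum.distrib sum_distrib_left)
  also have "\<dots> \<le> u * 1 + v * 1"
    using x y uv by (intro add_mono mult_left_mono) (auto simp: std_simplex_def)
  finally show "u *\<^sub>R x + v *\<^sub>R y \<in> std_simplex n"
    using x y uv by (auto simp: std_simplex_def scaleR_fun_def)
qed

lemma convex_body_std_simplex: "convex_body n (std_simplex n)"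
proof -
  have sub: "std_simplex n \<subseteq> topspace (Euclidean_space n)"
    by (auto simp: std_simplex_def topspace_Euclidean_space)
  have "compactin (Euclidean_space n) (std_simplex n)"
    using compact_std_simplex[of n] sub
    by (auto simp: Euclidean_space_def compactin_subtopology euclidean_product_topology
        topspace_Euclidean_space)
  moreover have "(Euclidean_space n) interior_of (std_simplex n) \<noteq> {}"
  proof -
    \<comment> \<open>Only finitely many coordinates are constrained, so \<open>U\<close> is open in
      the product topology on all functions.\<close>
    define U where "U = {y::nat \<Rightarrow> real. (\<forall>j\<in>{..<n}. 0 < y j) \<and> (\<Sum>j<n. y j) < 1}"
    have "open (\<Inter>j\<in>{..<n}. {y::nat \<Rightarrow> real. 0 < y j})"
      by (intro open_INT open_Collect_less ballI continuous_on_const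
          continuous_on_product_coordinates finite_lessThan)
    moreover have "open {y::nat \<Rightarrow> real. (\<Sum>j<n. y j) < 1}"
      by (intro open_Collect_less continuous_on_sum_coordinates continuous_on_const)
    moreover have "U = (\<Inter>j\<in>{..<n}. {y. 0 < y j}) \<inter> {y. (\<Sum>j<n. y j) < 1}"
      by (auto simp: U_def)
    ultimately have "open U"
      by auto
    then have "openin (Euclidean_space n) (topspace (Euclidean_space n) \<inter> U)"
      by (auto simp: Euclidean_space_def openin_subtopology euclidean_product_topology
          topspace_Euclidean_space)
    moreover have "topspace (Euclidean_space n) \<inter> U \<subseteq> std_simplex n"
      by (auto simp: U_def std_simplex_def topspace_Euclidean_space intro: less_imp_le)
    \<comment> \<open>The coordinates sum to \<open>n / (n + 1)\<close>, which is below 1 also for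
      \<open>n = 0\<close>.\<close>
    moreover have "(\<lambda>j. if j < n then 1 / (real n + 1) else 0) \<in> topspace (Euclidean_space n) \<inter> U"
      by (auto simp: U_def topspace_Euclidean_space)
    ultimately show ?thesis
      unfolding interior_of_def by blast
  qed
  ultimately show ?thesis
    by (simp add: convex_body_def convex_std_simplex)
qed

lemma mem_homothetic_std_simplex:
  assumes "0 < r" "\<forall>j<n. x j \<le> y j" "\<forall>j\<ge>n. x j = 0 \<and> y j = 0" "(\<Sum>j<n. y j - x j) \<le> r"
  shows "y \<in> (\<lambda>k. r *\<^sub>R k + x) ` std_simplex n"
proof
  show "y = r *\<^sub>R (\<lambda>j. (y j - x j) / r) + x"
    using assms by (auto simp: fun_eq_iff scaleR_fun_def)
  show "(\<lambda>j. (y j - x j) / r) \<in> std_simplex n"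
    using assms by (auto simp: std_simplex_def sum_divide_distrib[symmetric])
qed

text \<open>Membership of \<open>D\<close> itself is left open. For circumradii this keeps
  \<open>r\<close> positive, so that rescaling by \<open>1 / r\<close> is possible.\<close>

lemma Inf_eq_of_rays:
  fixes S :: "real set"
  assumes "\<And>r. r \<in> S \<Longrightarrow> D \<le> r" "\<And>r. D < r \<Longrightarrow> r \<in> S"
  shows "Inf S = D"
proof (rule antisym)
  have bdd: "bdd_below S"
    using assms(1) by (meson bdd_belowI)
  show "Inf S \<le> D"
    by (rule dense_ge) (use assms(2) bdd in \<open>auto intro: cInf_lower\<close>)
  show "D \<le> Inf S"
    using assms(2)[of "D + 1"] by (intro cInf_greatest assms(1)) auto
qed

text \<open>If \<open>r K + x\<close> contains \<open>A\<close>, its corner \<open>x\<close> lies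
  below every point of \<open>A\<close>, so \<open>- x j\<close> bounds the j-th maximum. Summing
  the coordinates of one point \<open>y0 = r k + x\<close> to 0 then bounds the sum of the
  \<open>- x j\<close> by \<open>r\<close>.\<close>

lemma circumradius_std_simplex:
  assumes "finite A" "A \<noteq> {}" "A \<subseteq> topspace (Euclidean_space n)"
    and sum0: "\<And>y. y \<in> A \<Longrightarrow> (\<Sum>j<n. y j) = 0"
  shows "circumradius n A (std_simplex n) = (\<Sum>j<n. Max ((\<lambda>y. - y j) ` A))"
proof -
  define M where "M j = Max ((\<lambda>y. - y j) ` A)" for j
  have M: "- y j \<le> M j" if "y \<in> A" for y j
    unfolding M_def using that assms(1) by (intro Max_ge) auto
  obtain y0 where y0: "y0 \<in> A"
    using assms(2) by auto
  \<comment> \<open>The numbers \<open>- y0 j\<close> below \<open>M j\<close> sum to 0.\<close>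
  have M0: "0 \<le> (\<Sum>j<n. M j)"
    using sum_mono[of "{..<n}" "\<lambda>j. - y0 j" M] M[OF y0] sum0[OF y0] by (simp add: sum_negf)
  show ?thesis
    unfolding circumradius_def M_def[symmetric]
  proof (rule Inf_eq_of_rays)
    fix r
    assume "r \<in> {r. 0 \<le> r \<and> (\<exists>x\<in>topspace (Euclidean_space n).
      A \<subseteq> (\<lambda>k. r *\<^sub>R k + x) ` std_simplex n)}"
    then obtain x where r: "0 \<le> r" and x: "A \<subseteq> (\<lambda>k. r *\<^sub>R k + x) ` std_simplex n"
      by auto
    have ge: "x j \<le> y j" if "y \<in> A" "j < n" for y j
      using x that r by (force simp: std_simplex_def scaleR_fun_def)
    have "M j \<le> - x j" if "j < n" for j
      unfolding M_def using assms(1,2) ge that by (subst Max_le_iff) auto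
    then have "(\<Sum>j<n. M j) \<le> - (\<Sum>j<n. x j)"
      using sum_mono[of "{..<n}" M "\<lambda>j. - x j"] by (simp add: sum_negf)
    also obtain k where k: "k \<in> std_simplex n" "y0 = r *\<^sub>R k + x"
      using x y0 by auto
    have "- (\<Sum>j<n. x j) = r * (\<Sum>j<n. k j)"
      using sum0[OF y0] k(2) by (simp add: scaleR_fun_def sum.distrib sum_distrib_left)
    also have "\<dots> \<le> r"
      using k(1) r by (simp add: std_simplex_def mult_left_le)
    finally show "(\<Sum>j<n. M j) \<le> r" .
  next
    fix r
    assume r: "(\<Sum>j<n. M j) < r"
    \<comment> \<open>The corner is the coordinatewise minimum of \<open>A\<close>. Every
      \<open>y\<close> in \<open>A\<close> sums to 0, so \<open>y - x\<close> has coordinate sum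
      equal to that of \<open>M\<close>, which is below \<open>r\<close>.\<close>
    define x where "x j = (if j < n then - M j else 0)" for j
    have "y \<in> (\<lambda>k. r *\<^sub>R k + x) ` std_simplex n" if "y \<in> A" for y
    proof (rule mem_homothetic_std_simplex)
      show "\<forall>j<n. x j \<le> y j"
        using M[OF that] by (simp add: x_def) (metis neg_le_iff_le minus_minus)
      show "\<forall>j\<ge>n. x j = 0 \<and> y j = 0"
        using that assms(3) by (auto simp: x_def topspace_Euclidean_space)
      show "(\<Sum>j<n. y j - x j) \<le> r"
        using sum0[OF that] r by (simp add: x_def sum.distrib)
    qed (use M0 r in auto)
    moreover have "x \<in> topspace (Euclidean_space n)"
      by (simp add: x_def topspace_Euclidean_space)
    ultimately show "r \<in> {r. 0 \<le> r \<and> (\<exists>x\<in>topspace (Euclidean_space n).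
      A \<subseteq> (\<lambda>k. r *\<^sub>R k + x) ` std_simplex n)}"
      using M0 r by (intro CollectI conjI bexI[of _ x] subsetI) auto
  qed
qed

text \<open>Every \<open>r \<ge> 0\<close> is admissible. The case is separate because
  \<open>Max\<close> says nothing about the empty set.\<close>

lemma circumradius_empty: "circumradius n {} K = 0"
  unfolding circumradius_def
  by (rule Inf_eq_of_rays) (auto intro!: exI[of _ "\<lambda>_. 0"] simp: topspace_Euclidean_space)

lemma Minkowski_embeddable_sum_Max:
  fixes n :: nat
  assumes "\<delta> {} = 0" and "\<And>x. x \<in> X \<Longrightarrow> (\<Sum>j<n. f j x) = 0"
    and "\<And>A. finite A \<Longrightarrow> A \<noteq> {} \<Longrightarrow> A \<subseteq> X \<Longrightarrow> \<delta> A = (\<Sum>j<n. Max (f j ` A))"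
  shows "Minkowski_embeddable X \<delta>"
proof -
  \<comment> \<open>The sign cancels the one in the circumradius formula.\<close>
  define \<phi> where "\<phi> x j = (if j < n then - f j x else 0)" for x j
  have \<phi>: "\<phi> \<in> X \<rightarrow> topspace (Euclidean_space n)"
    by (auto simp: \<phi>_def topspace_Euclidean_space)
  have "\<delta> A = circumradius n (\<phi> ` A) (std_simplex n)" if A: "finite A" "A \<subseteq> X" for A
  proof (cases "A = {}")
    case False
    have "circumradius n (\<phi> ` A) (std_simplex n) = (\<Sum>j<n. Max ((\<lambda>y. - y j) ` \<phi> ` A))"
      using A False \<phi> assms(2)
      by (intro circumradius_std_simplex) (auto simp: \<phi>_def sum_negf)
    also have "\<dots> = (\<Sum>j<n. Max (f j ` A))"
      by (intro sum.cong refl) (simp add: image_image \<phi>_def)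
    finally show ?thesis
      using assms(3)[OF A(1) False A(2)] by simp
  qed (simp add: assms(1) circumradius_empty)
  then show ?thesis
    using \<phi> convex_body_std_simplex unfolding Minkowski_embeddable_def by blast
qed

text \<open>Both sides are the width of \<open>g\<close> on \<open>A\<close>, its maximum minus its
  minimum.\<close>

lemma Max_abs_diff:
  fixes g :: "'a \<Rightarrow> real"
  assumes "finite A" "A \<noteq> {}"
  shows "Max {\<bar>g a - g a'\<bar> | a a'. a \<in> A \<and> a' \<in> A} = Max (g ` A) + Max ((\<lambda>a. - g a) ` A)"
proof (rule Max_eqI)
  have "{\<bar>g a - g a'\<bar> | a a'. a \<in> A \<and> a' \<in> A} = (\<lambda>(a, a'). \<bar>g a - g a'\<bar>) ` (A \<times> A)"
    by auto
  then show "finite {\<bar>g a - g a'\<bar> | a a'. a \<in> A \<and> a' \<in> A}"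
    using assms by simp
next
  fix z assume "z \<in> {\<bar>g a - g a'\<bar> | a a'. a \<in> A \<and> a' \<in> A}"
  then obtain a a' where z: "z = \<bar>g a - g a'\<bar>" "a \<in> A" "a' \<in> A"
    by auto
  have "g b \<le> Max (g ` A)" "- g b \<le> Max ((\<lambda>a. - g a) ` A)" if "b \<in> A" for b
    using that assms by (auto intro!: Max_ge)
  from this[OF z(2)] this[OF z(3)] show "z \<le> Max (g ` A) + Max ((\<lambda>a. - g a) ` A)"
    using z(1) by linarith
next
  have "Max (g ` A) \<in> g ` A" "Max ((\<lambda>a. - g a) ` A) \<in> (\<lambda>a. - g a) ` A"
    using assms by (intro Max_in; simp)+
  then obtain a a' where a: "a \<in> A" "Max (g ` A) = g a"
    and a': "a' \<in> A" "Max ((\<lambda>a. - g a) ` A) = - g a'"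
    by (elim imageE) metis
  have "g a' \<le> g a"
    using a a' assms by (metis Max_ge finite_imageI imageI)
  then show "Max (g ` A) + Max ((\<lambda>a. - g a) ` A) \<in> {\<bar>g a - g a'\<bar> | a a'. a \<in> A \<and> a' \<in> A}"
    using a a' by force
qed

lemma sum_lessThan_double:
  fixes g :: "nat \<Rightarrow> 'b::comm_monoid_add"
  shows "(\<Sum>j<2 * d. g j) = (\<Sum>i<d. g (2 * i) + g (2 * i + 1))"
  by (induction d) (simp_all add: add.assoc)

lemma L1_embeddable_imp_Minkowski_embeddable:
  assumes "finite X" "L1_embeddable X \<delta>"
  shows "Minkowski_embeddable X \<delta>"
proof -
  obtain d \<phi> where L1: "\<And>A. A \<subseteq> X \<Longrightarrow> \<delta> A = L1_diversity d (\<phi> ` A)"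
    using assms(2) unfolding L1_embeddable_def by blast
  \<comment> \<open>Each coordinate occupies two consecutive indices, with opposite signs, so each
    pair cancels in the sum.\<close>
  define f where "f j x = (if even j then \<phi> x (j div 2) else - \<phi> x (j div 2))" for j x
  show ?thesis
  proof (rule Minkowski_embeddable_sum_Max)
    show "\<delta> {} = 0"
      by (simp add: L1 L1_diversity_def)
    show "(\<Sum>j<2 * d. f j x) = 0" for x
      by (simp add: sum_lessThan_double f_def)
    fix A assume A: "finite A" "A \<noteq> {}" "A \<subseteq> X"
    have "\<delta> A = (\<Sum>i<d. Max ((\<lambda>y. y i) ` \<phi> ` A) + Max ((\<lambda>y. - y i) ` \<phi> ` A))"
      using A by (simp add: L1 L1_diversity_def Max_abs_diff)
    also have "\<dots> = (\<Sum>j<2 * d. Max (f j ` A))"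
      by (simp add: sum_lessThan_double f_def image_image)
    finally show "\<delta> A = (\<Sum>j<2 * d. Max (f j ` A))" .
  qed
qed

text \<open>By monotonicity the first three functions are nonnegative, so each contributes exactly
  when \<open>A\<close> contains its point. By the triangle inequality the next three are
  nonpositive, so each contributes only when \<open>A\<close> is the singleton of its point.\<close>

lemma three_point_Minkowski_embeddable:
  assumes \<delta>: "diversity X \<delta>" and "card X = 3"
  shows "Minkowski_embeddable X \<delta>"
proof -
  obtain p q r where X: "X = {p, q, r}" and ne: "p \<noteq> q" "p \<noteq> r" "q \<noteq> r"
    using assms(2) unfolding card_3_iff by blast
  have tri: "\<delta> (A \<union> C) \<le> \<delta> (A \<union> B) + \<delta> (B \<union> C)"
    if "A \<subseteq> X" "B \<subseteq> X" "C \<subseteq> X" "B \<noteq> {}" for A B C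
    using \<delta> that X unfolding diversity_def by (meson finite.emptyI finite.insertI finite_subset)
  have zero: "\<delta> A = 0" if "A \<subseteq> X" "card A \<le> 1" for A
    using \<delta> that X unfolding diversity_def by (meson finite.emptyI finite.insertI finite_subset)
  have z: "\<delta> {} = 0" "\<delta> {p} = 0" "\<delta> {q} = 0" "\<delta> {r} = 0"
    by (auto intro!: zero simp: X)
  define t where "t = \<delta> {p, q, r}"
  \<comment> \<open>This constant makes the seven values at each point sum to 0.\<close>
  define c where "c = \<delta> {p, q} + \<delta> {p, r} + \<delta> {q, r} - 2 * t"
  \<comment> \<open>Monotonicity is (D2) with \<open>C = {}\<close> and \<open>B\<close> a
    singleton, where \<open>\<delta>\<close> vanishes.\<close>
  have lower: "\<delta> {q, r} \<le> t" "\<delta> {p, r} \<le> t" "\<delta> {p, q} \<le> t"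
    using tri[of "{q, r}" "{p}" "{}"] tri[of "{p, r}" "{q}" "{}"] tri[of "{p, q}" "{r}" "{}"] z
    by (simp_all add: X t_def insert_commute)
  \<comment> \<open>Here \<open>B\<close> is the point shared by the two pairs on the right.\<close>
  have upper: "t \<le> \<delta> {p, q} + \<delta> {p, r}" "t \<le> \<delta> {p, q} + \<delta> {q, r}" "t \<le> \<delta> {p, r} + \<delta> {q, r}"
    using tri[of "{p, q}" "{p}" "{r}"] tri[of "{p, q}" "{q}" "{r}"] tri[of "{p, r}" "{r}" "{q}"]
    by (simp_all add: X t_def insert_commute)
  define f where "f j x = [if x = p then t - \<delta> {q, r} else 0,
      if x = q then t - \<delta> {p, r} else 0,
      if x = r then t - \<delta> {p, q} else 0,
      if x = p then t - \<delta> {p, q} - \<delta> {p, r} else 0,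
      if x = q then t - \<delta> {p, q} - \<delta> {q, r} else 0,
      if x = r then t - \<delta> {p, r} - \<delta> {q, r} else 0, c] ! j" for j and x :: 'a
  \<comment> \<open>A general \<open>g\<close> covers both uses: evaluation at a point and the
    maximum over \<open>A\<close>.\<close>
  have f_sum: "(\<Sum>j<7. g (f j)) = g (f 0) + g (f 1) + g (f 2) + g (f 3) + g (f 4) + g (f 5) + g (f 6)"
    for g :: "('a \<Rightarrow> real) \<Rightarrow> real"
    by (simp add: eval_nat_numeral)
  show ?thesis
  proof (rule Minkowski_embeddable_sum_Max)
    show "(\<Sum>j<7. f j x) = 0" if "x \<in> X" for x
      using that ne unfolding X f_sum[of "\<lambda>h. h x"] by (auto simp: f_def c_def)
    fix A assume A: "finite A" "A \<noteq> {}" "A \<subseteq> X"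
    then have "A \<in> {{p}, {q}, {r}, {p, q}, {p, r}, {q, r}, {p, q, r}}"
      unfolding X by blast
    then show "\<delta> A = (\<Sum>j<7. Max (f j ` A))"
      using ne z lower upper unfolding f_sum[of "\<lambda>h. Max (h ` A)"]
      by (auto simp: f_def c_def t_def max_def)
  qed (rule z)
qed

theorem corollary18:
  fixes X :: "'a set" and \<delta> :: "'a set \<Rightarrow> real"
  assumes "diversity X \<delta>"
    and "card X = 3 \<or> (finite X \<and> L1_embeddable X \<delta>)"
  shows "Minkowski_embeddable X \<delta>"
  using assms three_point_Minkowski_embeddable L1_embeddable_imp_Minkowski_embeddable by blast

end
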